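(* Let $Z\in(-1,0)$ and let $\Pi_Z=(\phi_1,\phi_2,\phi_3,0,0,0)$ be the stationary kink/anti-kink profile (with all speeds $c_j=1$) $$\phi_1(x)=4\arctan\left(e^{-(x-a_1)}\right)\ (x<0),\qquad \phi_i(x)=4\arctan\left(e^{-(x-a_1)}\right)\ (x>0,\ i=2,3),$$ where $a_1=a_1(Z)\in\mathbb R$ is determined by $$-\frac{e^{a_1}}{1+e^{2a_1}}=Z\arctan\left(e^{a_1}\right).$$ Then $\Pi_Z$ is spectrally unstable for the sine-Gordon model on the $\mathcal Y$-junction with $\delta$-interaction of intensity $Z$ at the vertex.
   Context: $\mathcal Y$ is the metric graph with edges $E_1=(-\infty,0)$, $E_2=E_3=(0,\infty)$ joined at the vertex $\nu=0$. $L^2(\mathcal Y)$ and $H^m(\mathcal Y)$ are the direct sums of the corresponding spaces on the edges. $\mathcal E(\mathcal Y)=\{(v_j)_{j=1}^3\in H^1(\mathcal Y): v_1(0-)=v_2(0+)=v_3(0+)\}$. The sine-Gordon model (speeds $c_j=1$) is $\partial_tu_j=v_j$, $\partial_tv_j=\partial_x^2u_j-\sin u_j$ on $E_j$, $j=1,2,3$, with vertex conditions $u_1(0-)=u_2(0+)=u_3(0+)$ and $\sum_{j=2}^3\partial_xu_j(0+)-\partial_xu_1(0-)=Zu_1(0-)$. The profile satisfies $-\phi_j''+\sin\phi_j=0$ on $E_j$ and the vertex conditions (which force equal shifts $a_1=a_2=a_3$ and the displayed equation for $a_1$). It is not in $H^2(\mathcal Y)$ because $\phi_1(-\infty)=2\pi$,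 while $\phi_i(+\infty)=0$ for $i=2,3$. Stability is understood with respect to finite energy perturbations: one writes $(u,v)=(\Phi+P,Q)$ with $\Phi=(\phi_j)_{j=1}^3$ and $(P,Q)\in H^1(\mathcal Y)\times L^2(\mathcal Y)$, and linearizes the system for $(P,Q)$ around $(0,0)$. This linearization is $\mathbf z_t=J\mathcal E\,\mathbf z$ with $J\mathcal E(\mathbf u,\mathbf v)=(\mathbf v,-\mathcal L_{ak,Z}\mathbf u)$, where $\mathcal L_{ak,Z}\mathbf v=\left(-v_j''+\cos(\phi_j)v_j\right)_{j=1}^3$ has domain $$D(\mathcal L_{ak,Z})=\Big\{\mathbf v\in H^2(\mathcal Y): v_1(0-)=v_2(0+)=v_3(0+),\ \sum_{j=2}^3v_j'(0+)-v_1'(0-)=Zv_1(0-)\Big\}.$$ $J\mathcal E$ is considered in $\mathcal E(\mathcal Y)\times L^2(\mathcal Y)$ with domain $D(\mathcal L_{ak,Z})\times\mathcal E(\mathcal Y)$. The profile is called spectrally stable if $\sigma(J\mathcal E)\subset i\mathbb R$, and spectrally unstable otherwise. *)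

theory Defs
  imports "HOL-Analysis.Analysis"
begin

section \<open>The Y-junction\<close>

datatype edge = E1 | E2 | E3

fun Edge :: "edge \<Rightarrow> real set" where
  "Edge E1 = {..<0}"
| "Edge E2 = {0<..}"
| "Edge E3 = {0<..}"

text \<open>The one-sided approach to the vertex \<open>0\<close> along each edge.\<close>

fun vertex :: "edge \<Rightarrow> real filter" where
  "vertex E1 = at_left 0"
| "vertex E2 = at_right 0"
| "vertex E3 = at_right 0"

text \<open>A function on the junction is a family of three functions on the real line, of which only
  the restriction of the \<open>e\<close>-th one to \<open>Edge e\<close> is meaningful.  Elements of \<open>L\<^sup>2\<close> and of Sobolev
  spaces are represented by functions, equality being equality almost everywhere.  The spaces are
  complex because spectra are taken in the complex plane.\<close>

type_synonym yfun = "edge \<Rightarrow> real \<Rightarrow> complex"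

definition ae_eq :: "yfun \<Rightarrow> yfun \<Rightarrow> bool" where
  "ae_eq u v \<longleftrightarrow> (\<forall>e. AE x\<in>Edge e in lebesgue. u e x = v e x)"


section \<open>Sobolev spaces\<close>

definition test_function :: "real set \<Rightarrow> (real \<Rightarrow> real) \<Rightarrow> bool" where
  "test_function S \<phi> \<longleftrightarrow>
     (\<forall>n x. (deriv ^^ n) \<phi> differentiable (at x)) \<and>
     (\<exists>K. compact K \<and> K \<subseteq> S \<and> (\<forall>x. x \<notin> K \<longrightarrow> \<phi> x = 0))"

definition locally_integrable :: "real set \<Rightarrow> (real \<Rightarrow> complex) \<Rightarrow> bool" where
  "locally_integrable S f \<longleftrightarrow> (\<forall>K. compact K \<and> K \<subseteq> S \<longrightarrow> set_integrable lebesgue K f)"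

definition weak_derivative :: "real set \<Rightarrow> (real \<Rightarrow> complex) \<Rightarrow> (real \<Rightarrow> complex) \<Rightarrow> bool" where
  "weak_derivative S f g \<longleftrightarrow>
     locally_integrable S f \<and> locally_integrable S g \<and>
     (\<forall>\<phi>. test_function S \<phi> \<longrightarrow>
        (LINT x:S|lebesgue. deriv \<phi> x *\<^sub>R f x) = - (LINT x:S|lebesgue. \<phi> x *\<^sub>R g x))"

definition L2 :: "real set \<Rightarrow> (real \<Rightarrow> complex) set" where
  "L2 S = {f. set_borel_measurable lebesgue S f \<and>
              set_integrable lebesgue S (\<lambda>x. (norm (f x))\<^sup>2)}"

primrec Sobolev :: "nat \<Rightarrow> real set \<Rightarrow> (real \<Rightarrow> complex) set" where
  "Sobolev 0 S = L2 S"
| "Sobolev (Suc m) S = {f \<in> L2 S. \<exists>g \<in> Sobolev m S. weak_derivative S f g}"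

definition L2Y :: "yfun set" where
  "L2Y = {u. \<forall>e. u e \<in> L2 (Edge e)}"

definition HY :: "nat \<Rightarrow> yfun set" where
  "HY m = {u. \<forall>e. u e \<in> Sobolev m (Edge e)}"

text \<open>The value at the vertex of (the continuous representative of) a class of functions on an
  edge.\<close>

definition has_trace :: "edge \<Rightarrow> (real \<Rightarrow> complex) \<Rightarrow> complex \<Rightarrow> bool" where
  "has_trace e f l \<longleftrightarrow>
     (\<exists>g. continuous_on (Edge e) g \<and> (AE x\<in>Edge e in lebesgue. f x = g x) \<and>
          (g \<longlongrightarrow> l) (vertex e))"

definition EY :: "yfun set" where
  "EY = {v \<in> HY 1. \<exists>l. \<forall>e. has_trace e (v e) l}"


section \<open>The energy space\<close>

definition L2_norm_sq :: "real set \<Rightarrow> (real \<Rightarrow> complex) \<Rightarrow> real" where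
  "L2_norm_sq S f = (LINT x:S|lebesgue. (norm (f x))\<^sup>2)"

text \<open>The choice is immaterial: weak derivatives are unique almost everywhere.\<close>

definition weak_deriv :: "real set \<Rightarrow> (real \<Rightarrow> complex) \<Rightarrow> (real \<Rightarrow> complex)" where
  "weak_deriv S f = (SOME g. weak_derivative S f g)"

definition energy_space :: "(yfun \<times> yfun) set" where
  "energy_space = EY \<times> L2Y"

text \<open>The norm of \<open>H\<^sup>1 \<times> L\<^sup>2\<close>.\<close>

fun energy_norm :: "yfun \<times> yfun \<Rightarrow> real" where
  "energy_norm (u, v) = sqrt (\<Sum>e\<in>{E1, E2, E3}.
     L2_norm_sq (Edge e) (u e) + L2_norm_sq (Edge e) (weak_deriv (Edge e) (u e)) +
     L2_norm_sq (Edge e) (v e))"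

fun state_eq :: "yfun \<times> yfun \<Rightarrow> yfun \<times> yfun \<Rightarrow> bool" where
  "state_eq (u, v) (u', v') \<longleftrightarrow> ae_eq u u' \<and> ae_eq v v'"


section \<open>Spectrum of an unbounded operator in the energy space\<close>

text \<open>An operator is given by its graph, a set of pairs (argument, value).
  \<open>resolvent_eq A z x y\<close> says that \<open>x\<close> lies in the domain and \<open>(z - A) x = y\<close>.  The resolvent set
  consists of those \<open>z\<close> for which \<open>z - A\<close> is a bijection from the domain onto the space, with
  bounded inverse.\<close>

fun resolvent_eq ::
  "((yfun \<times> yfun) \<times> (yfun \<times> yfun)) set \<Rightarrow> complex \<Rightarrow> yfun \<times> yfun \<Rightarrow> yfun \<times> yfun \<Rightarrow> bool" where
  "resolvent_eq A z (u, v) y \<longleftrightarrow>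
     (\<exists>p q. ((u, v), (p, q)) \<in> A \<and>
            state_eq (\<lambda>e x. z * u e x - p e x, \<lambda>e x. z * v e x - q e x) y)"

definition resolvent_set :: "((yfun \<times> yfun) \<times> (yfun \<times> yfun)) set \<Rightarrow> complex set" where
  "resolvent_set A = {z.
     (\<forall>y\<in>energy_space. \<exists>x. resolvent_eq A z x y) \<and>
     (\<forall>y\<in>energy_space. \<forall>x x'.
        resolvent_eq A z x y \<and> resolvent_eq A z x' y \<longrightarrow> state_eq x x') \<and>
     (\<exists>C. \<forall>y\<in>energy_space. \<forall>x.
        resolvent_eq A z x y \<longrightarrow> energy_norm x \<le> C * energy_norm y)}"

definition spectrum :: "((yfun \<times> yfun) \<times> (yfun \<times> yfun)) set \<Rightarrow> complex set" where
  "spectrum A = - resolvent_set A"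


section \<open>The sine-Gordon model with delta interaction at the vertex\<close>

text \<open>States of the nonlinear system are real-valued and need not be integrable.  A stationary
  state \<open>(u, v)\<close> satisfies \<open>v = 0\<close> and \<open>u'' - sin u = 0\<close> on the edges, continuity at the vertex,
  and the jump condition of intensity \<open>Z\<close>.\<close>

fun stationary :: "real \<Rightarrow> (edge \<Rightarrow> real \<Rightarrow> real) \<times> (edge \<Rightarrow> real \<Rightarrow> real) \<Rightarrow> bool" where
  "stationary Z (u, v) \<longleftrightarrow>
     (\<forall>e. \<forall>x\<in>Edge e. v e x = 0) \<and>
     (\<exists>u' a b.
        (\<forall>e. \<forall>x\<in>Edge e. (u e has_real_derivative u' e x) (at x) \<and>
                        (u' e has_real_derivative sin (u e x)) (at x)) \<and>
        (\<forall>e. (u e \<longlongrightarrow> a) (vertex e)) \<and>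
        (\<forall>e. (u' e \<longlongrightarrow> b e) (vertex e)) \<and>
        b E2 + b E3 - b E1 = Z * a)"

definition D_L :: "real \<Rightarrow> yfun set" where
  "D_L Z = {u \<in> HY 2. \<exists>u' a b.
     (\<forall>e. weak_derivative (Edge e) (u e) (u' e)) \<and>
     (\<forall>e. has_trace e (u e) a) \<and>
     (\<forall>e. has_trace e (u' e) (b e)) \<and>
     b E2 + b E3 - b E1 = of_real Z * a}"

text \<open>Graphs of \<open>L u = - u'' + cos(\<Phi>) u\<close> on \<open>D_L Z\<close> and of the linearization
  \<open>(u, v) \<mapsto> (v, - L u)\<close> on \<open>D_L Z \<times> EY\<close>; all representatives \<open>u''\<close> of the second weak derivative
  are admitted.\<close>

definition L_op :: "real \<Rightarrow> (edge \<Rightarrow> real \<Rightarrow> real) \<Rightarrow> (yfun \<times> yfun) set" where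
  "L_op Z \<Phi> = {(u, w). u \<in> D_L Z \<and> (\<exists>u' u''.
     (\<forall>e. weak_derivative (Edge e) (u e) (u' e)) \<and>
     (\<forall>e. weak_derivative (Edge e) (u' e) (u'' e)) \<and>
     w = (\<lambda>e x. - u'' e x + of_real (cos (\<Phi> e x)) * u e x))}"

definition JE_op ::
  "real \<Rightarrow> (edge \<Rightarrow> real \<Rightarrow> real) \<Rightarrow> ((yfun \<times> yfun) \<times> (yfun \<times> yfun)) set" where
  "JE_op Z \<Phi> = {((u, v), (v, \<lambda>e x. - w e x)) | u v w. (u, w) \<in> L_op Z \<Phi> \<and> v \<in> EY}"

text \<open>The linearization around \<open>U = (\<Phi>, 0)\<close> depends on \<open>\<Phi>\<close> only.\<close>

definition spectrally_stable ::
  "real \<Rightarrow> (edge \<Rightarrow> real \<Rightarrow> real) \<times> (edge \<Rightarrow> real \<Rightarrow> real) \<Rightarrow> bool" where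
  "spectrally_stable Z U \<longleftrightarrow> spectrum (JE_op Z (fst U)) \<subseteq> {z. Re z = 0}"

definition spectrally_unstable ::
  "real \<Rightarrow> (edge \<Rightarrow> real \<Rightarrow> real) \<times> (edge \<Rightarrow> real \<Rightarrow> real) \<Rightarrow> bool" where
  "spectrally_unstable Z U \<longleftrightarrow> \<not> spectrally_stable Z U"

text \<open>With equal speeds and equal shifts the kink/anti-kink profile is given by one formula on all
  edges.\<close>

definition kink_antikink ::
  "real \<Rightarrow> (edge \<Rightarrow> real \<Rightarrow> real) \<times> (edge \<Rightarrow> real \<Rightarrow> real)" where
  "kink_antikink a = (\<lambda>e x. 4 * arctan (exp (- (x - a))), \<lambda>e x. 0)"

end

theory Submission
  imports Defs
begin

text \<open>With \<open>w = 2 arctan (exp a)\<close> the equation for the shift reads \<open>sin w = - Z w\<close> with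
  \<open>0 < w < \<pi>\<close>, and \<open>tanh a = - cos w\<close>.  Rolle's theorem on \<open>[0, w]\<close> gives \<open>\<xi> < w\<close> with
  \<open>cos \<xi> = - Z\<close>, hence \<open>Z < tanh a\<close>.

  Since \<open>cos \<phi> = 1 - 2 sech\<^sup>2 (x - a)\<close> is a reflectionless potential, the decaying solutions of
  \<open>- f'' + cos \<phi> f = (1 - k\<^sup>2) f\<close> are known in closed form: \<open>exp (- k x) (k + tanh (x - a))\<close> at
  \<open>+\<infinity>\<close>, and the same with \<open>- k\<close> for \<open>k\<close> at \<open>-\<infinity>\<close>.  Matching them at the vertex leaves one cubic
  equation in \<open>k\<close>, whose left-hand side is negative at \<open>k = 1\<close> exactly when \<open>Z < tanh a\<close>; so it has
  a root \<open>k > 1\<close>, and \<open>\<surd>(k\<^sup>2 - 1) > 0\<close> is an eigenvalue of the linearization.\<close>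

section \<open>The shift\<close>

text \<open>Rolle's theorem. Taken from the trivial root 0 it yields the bound on the shift; taken
  between two positive roots it yields uniqueness.\<close>

lemma sin_linear_roots_critical_point:
  fixes Z v w :: real
  assumes "v < w" "sin v + Z * v = 0" "sin w + Z * w = 0"
  obtains \<xi> where "v < \<xi>" "\<xi> < w" "cos \<xi> = - Z"
proof -
  let ?g = "\<lambda>w. sin w + Z * w"
  have "\<exists>\<xi>>v. \<xi> < w \<and> (\<lambda>h. (cos \<xi> + Z) * h) = (\<lambda>h. 0)"
  proof (rule Rolle_deriv[of v w ?g])
    show "continuous_on {v..w} ?g" by (intro continuous_intros)
    show "(?g has_derivative (\<lambda>h. (cos x + Z) * h)) (at x)" for x
      by (auto intro!: derivative_eq_intros simp: algebra_simps)
  qed (use assms in auto)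
  then obtain \<xi> where "v < \<xi>" "\<xi> < w" and *: "(\<lambda>h. (cos \<xi> + Z) * h) = (\<lambda>h. 0)" by blast
  moreover from fun_cong[OF *, of 1] have "cos \<xi> = - Z" by simp
  ultimately show thesis using that by blast
qed

text \<open>The function vanishes at 0 with slope \<open>1 + Z > 0\<close>, so it is positive just
  to the right of 0, while at \<open>pi\<close> its value is \<open>Z * pi < 0\<close>.\<close>

lemma sin_linear_root_exists:
  fixes Z :: real
  assumes "- 1 < Z" "Z < 0"
  obtains w where "0 < w" "w < pi" "sin w + Z * w = 0"
proof -
  let ?g = "\<lambda>w. sin w + Z * w"
  have "DERIV ?g 0 :> 1 + Z" by (auto intro!: derivative_eq_intros)
  from DERIV_pos_inc_right[OF this] assms obtain d where
    d: "d > 0" "\<And>h. 0 < h \<Longrightarrow> h < d \<Longrightarrow> ?g 0 < ?g (0 + h)" by auto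
  define h where "h = min (d / 2) (pi / 2)"
  have h: "0 < h" "h < d" "h < pi" using d(1) pi_gt_zero unfolding h_def by (auto simp: min_def)
  have pos: "0 < ?g h" using d(2)[of h] h by simp
  have neg: "?g pi < 0" using assms(2) by (simp add: mult_neg_pos)
  have "\<exists>x\<ge>h. x \<le> pi \<and> ?g x = 0"
    using h pos neg by (intro IVT2') (auto intro!: continuous_intros)
  then obtain x where x: "h \<le> x" "x \<le> pi" "?g x = 0" by blast
  with neg h have "x \<noteq> pi" "0 < x" by auto
  with x show thesis using that by force
qed

text \<open>Together with the root 0 there would be three roots, hence two critical points in
  \<open>(0, pi)\<close> with the same cosine.\<close>

lemma sin_linear_root_unique_aux:
  fixes Z :: real
  assumes "0 < w" "w < w'" "w' < pi" "sin w + Z * w = 0" "sin w' + Z * w' = 0"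
  shows False
proof -
  obtain \<xi> where \<xi>: "0 < \<xi>" "\<xi> < w" "cos \<xi> = - Z"
    using sin_linear_roots_critical_point[of 0 w Z] assms(1,4) by auto
  obtain \<eta> where \<eta>: "w < \<eta>" "\<eta> < w'" "cos \<eta> = - Z"
    using sin_linear_roots_critical_point[OF assms(2,4,5)] by blast
  have "cos \<eta> < cos \<xi>" using \<xi> \<eta> assms by (intro cos_monotone_0_pi) auto
  then show False using \<xi> \<eta> by simp
qed

lemma sin_linear_root_unique:
  fixes Z :: real
  assumes "0 < w" "w < pi" "sin w + Z * w = 0" "0 < w'" "w' < pi" "sin w' + Z * w' = 0"
  shows "w = w'"
  using sin_linear_root_unique_aux[of w w' Z] sin_linear_root_unique_aux[of w' w Z] assms
  by (metis linorder_neqE_linordered_idom)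

section \<open>Half-angle identities and the equation for the shift\<close>

lemma sin_double_arctan: "sin (2 * arctan y) = 2 * y / (1 + y\<^sup>2)" for y :: real
  by (simp add: sin_double sin_arctan cos_arctan add_nonneg_nonneg)

lemma cos_double_arctan: "cos (2 * arctan y) = (1 - y\<^sup>2) / (1 + y\<^sup>2)" for y :: real
  using cos_tan_half[of "arctan y"] by (simp add: tan_arctan)

lemma exp_double_real: "exp (2 * a) = (exp a)\<^sup>2" for a :: real
  by (simp add: exp_double)

text \<open>This identity turns angles of the profile into \<open>tanh\<close>, both in the bound on
  the shift and in the potential.\<close>

lemma cos_double_arctan_exp: "cos (2 * arctan (exp s)) = - tanh s" for s :: real
proof -
  have "tanh s = ((exp s)\<^sup>2 - 1) / ((exp s)\<^sup>2 + 1)"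
    using tanh_ln_real[of "exp s"] by simp
  then show ?thesis by (simp add: cos_double_arctan add.commute minus_divide_left)
qed

lemma shift_equation_iff:
  fixes Z a :: real
  shows "- exp a / (1 + exp (2 * a)) = Z * arctan (exp a) \<longleftrightarrow>
    sin (2 * arctan (exp a)) + Z * (2 * arctan (exp a)) = 0"
  unfolding sin_double_arctan exp_double_real by (auto simp: algebra_simps)

text \<open>The map sending \<open>a\<close> to \<open>2 * arctan (exp a)\<close> is a bijection
  from the real line onto \<open>(0, pi)\<close>, where the root is unique.\<close>

lemma shift_exists_unique:
  fixes Z :: real
  assumes "- 1 < Z" "Z < 0"
  shows "\<exists>!a. - exp a / (1 + exp (2 * a)) = Z * arctan (exp a)"
proof -
  from sin_linear_root_exists[OF assms] obtain w
    where w: "0 < w" "w < pi" "sin w + Z * w = 0" by blast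
  define a where "a = ln (tan (w / 2))"
  have "0 < tan (w / 2)" using w by (intro tan_gt_zero) auto
  then have a: "2 * arctan (exp a) = w" using w by (simp add: a_def arctan_tan)
  show ?thesis unfolding shift_equation_iff
  proof (rule ex1I[of _ a])
    show "sin (2 * arctan (exp a)) + Z * (2 * arctan (exp a)) = 0" using a w by simp
    fix b assume b: "sin (2 * arctan (exp b)) + Z * (2 * arctan (exp b)) = 0"
    have "0 < arctan (exp b)" "2 * arctan (exp b) < pi" using arctan_ubound[of "exp b"] by simp_all
    then have "2 * arctan (exp b) = 2 * arctan (exp a)"
      unfolding a using b by (intro sin_linear_root_unique[OF _ _ _ w]) simp_all
    then show "b = a" by (simp add: arctan_eq_iff)
  qed
qed

text \<open>Cosine decreases on \<open>[0, pi]\<close>, so it is smaller at the root than at the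
  critical point to its left. This inequality is all that the instability argument needs to know
  about the shift.\<close>

lemma shift_tanh_gt:
  fixes Z a :: real
  assumes "- exp a / (1 + exp (2 * a)) = Z * arctan (exp a)"
  shows "Z < tanh a"
proof -
  let ?w = "2 * arctan (exp a)"
  have "sin ?w + Z * ?w = 0" using assms unfolding shift_equation_iff .
  then obtain \<xi> where \<xi>: "0 < \<xi>" "\<xi> < ?w" "cos \<xi> = - Z"
    using sin_linear_roots_critical_point[of 0 ?w Z] by auto
  then have "cos ?w < - Z"
    using arctan_ubound[of "exp a"] cos_monotone_0_pi[of \<xi> ?w] by simp
  then show ?thesis by (simp add: cos_double_arctan_exp)
qed


section \<open>The profile\<close>

text \<open>First-order form of the kink equation: the derivative of the profile is -2 times the
  sine of half the profile.\<close>

lemma kink_deriv: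
  fixes a x :: real
  shows "((\<lambda>x. 4 * arctan (exp (- (x - a)))) has_real_derivative
           - 2 * sin (2 * arctan (exp (- (x - a))))) (at x)"
  unfolding sin_double_arctan
  by (auto intro!: derivative_eq_intros simp: field_simps)

lemma kink_second_deriv:
  fixes a x :: real
  shows "((\<lambda>x. - 2 * sin (2 * arctan (exp (- (x - a))))) has_real_derivative
           sin (4 * arctan (exp (- (x - a))))) (at x)"
proof -
  let ?t = "\<lambda>x. arctan (exp (- (x - a)))"
  have "((\<lambda>y. - 2 * sin (y / 2)) has_real_derivative - cos (y / 2)) (at y)" for y :: real
    by (auto intro!: derivative_eq_intros)
  from DERIV_chain2[OF this kink_deriv]
  have "((\<lambda>x. - 2 * sin ((4 * ?t x) / 2)) has_real_derivative
      - cos ((4 * ?t x) / 2) * (- 2 * sin (2 * ?t x))) (at x)" .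
  moreover have "sin (4 * ?t x) = 2 * sin (2 * ?t x) * cos (2 * ?t x)"
    using sin_double[of "2 * ?t x"] by simp
  ultimately show ?thesis by (simp add: mult_ac)
qed

lemma kink_cos: "cos (4 * arctan (exp (- (x - a)))) = 2 * (tanh (x - a))\<^sup>2 - 1" for x a :: real
  using cos_double_cos[of "2 * arctan (exp (- (x - a)))"] cos_double_arctan_exp[of "- (x - a)"]
    tanh_minus[of "x - a"] by simp

lemma vertex_le_at: "vertex e \<le> at 0"
  by (cases e) (simp_all add: at_le)

text \<open>One smooth function serves all three edges, so continuity is automatic and the jump of
  the derivative, two outgoing copies minus one incoming, is the derivative at 0. The jump condition
  is then the shift equation, rescaled.\<close>

lemma stationary_kink:
  assumes "- exp a / (1 + exp (2 * a)) = Z * arctan (exp a)"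
  shows "stationary Z (kink_antikink a)"
proof -
  let ?u = "\<lambda>x. 4 * arctan (exp (- (x - a)))"
  let ?u' = "\<lambda>x. - 2 * sin (2 * arctan (exp (- (x - a))))"
  have lim: "(?u \<longlongrightarrow> ?u 0) (vertex e)" "(?u' \<longlongrightarrow> ?u' 0) (vertex e)" for e
    by (rule tendsto_mono[OF vertex_le_at], rule DERIV_isCont[unfolded isCont_def],
        rule kink_deriv kink_second_deriv)+
  have jump: "?u' 0 + ?u' 0 - ?u' 0 = Z * ?u 0"
    using assms[unfolded shift_equation_iff] unfolding diff_0 minus_minus by linarith
  show ?thesis
    unfolding kink_antikink_def stationary.simps
  proof (intro conjI)
    show "\<exists>u' c b. (\<forall>e. \<forall>x\<in>Edge e. (?u has_real_derivative u' e x) (at x) \<and>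
                        (u' e has_real_derivative sin (?u x)) (at x)) \<and>
        (\<forall>e. (?u \<longlongrightarrow> c) (vertex e)) \<and> (\<forall>e. (u' e \<longlongrightarrow> b e) (vertex e)) \<and>
        b E2 + b E3 - b E1 = Z * c"
      by (rule exI[of _ "\<lambda>_. ?u'"], rule exI[of _ "?u 0"], rule exI[of _ "\<lambda>_. ?u' 0"])
        (intro conjI allI ballI kink_deriv kink_second_deriv lim jump)
  qed simp
qed


section \<open>Classical functions in Sobolev spaces\<close>

lemma compact_imp_set_integrable_lebesgue:
  fixes f :: "real \<Rightarrow> 'a::euclidean_space"
  assumes "compact K" "continuous_on K f"
  shows "set_integrable lebesgue K f"
  using borel_integrable_compact[OF assms] assms(1)
  unfolding set_integrable_def
  by (subst integrable_completion)
    (auto intro!: borel_measurable_continuous_on_indicator assms borel_compact)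

section \<open>Weak derivatives of classical functions\<close>

lemma test_function_derivative:
  assumes "test_function S \<phi>"
  shows "(\<phi> has_real_derivative deriv \<phi> x) (at x)" "continuous_on UNIV (deriv \<phi>)"
proof -
  have "\<phi> differentiable (at y)" "deriv \<phi> differentiable (at y)" for y
    using assms[unfolded test_function_def, THEN conjunct1, rule_format, of 0 y]
      assms[unfolded test_function_def, THEN conjunct1, rule_format, of 1 y] by auto
  then show "(\<phi> has_real_derivative deriv \<phi> x) (at x)" "continuous_on UNIV (deriv \<phi>)"
    by (auto simp: DERIV_deriv_iff_real_differentiable differentiable_imp_continuous_within
        intro!: continuous_at_imp_continuous_on)
qed

lemma deriv_eq_0_outside:
  fixes \<phi> :: "real \<Rightarrow> real"
  assumes "closed K" "\<And>x. x \<notin> K \<Longrightarrow> \<phi> x = 0" "x \<notin> K"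
  shows "deriv \<phi> x = 0"
proof -
  have "eventually (\<lambda>y. y \<in> - K) (nhds x)"
    using assms by (intro eventually_nhds_in_open) auto
  then have "eventually (\<lambda>y. \<phi> y = 0) (nhds x)"
    by eventually_elim (use assms in auto)
  then have "deriv \<phi> x = deriv (\<lambda>_. 0) x" by (intro deriv_cong_ev) auto
  then show ?thesis by simp
qed

text \<open>Integration by parts on an interval whose endpoints lie outside the support of the test
  function. As \<open>f\<close> is continuously differentiable on the whole line, the boundary of
  \<open>S\<close> needs no attention.\<close>

lemma weak_derivative_classical:
  fixes f g :: "real \<Rightarrow> complex"
  assumes der: "\<And>x. (f has_vector_derivative g x) (at x)" and cont: "continuous_on UNIV g"
  shows "weak_derivative S f g"
  unfolding weak_derivative_def
proof (intro conjI allI impI)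
  have contf: "continuous_on UNIV f"
    using der by (auto intro!: continuous_at_imp_continuous_on has_vector_derivative_continuous)
  show "locally_integrable S f" "locally_integrable S g"
    unfolding locally_integrable_def
    by (auto intro!: compact_imp_set_integrable_lebesgue intro: continuous_on_subset[OF contf]
        continuous_on_subset[OF cont])
  fix \<phi> assume test: "test_function S \<phi>"
  then obtain K where K: "compact K" "K \<subseteq> S" "\<And>x. x \<notin> K \<Longrightarrow> \<phi> x = 0"
    unfolding test_function_def by blast
  note d\<phi> = test_function_derivative[OF test]
  have contphi: "continuous_on UNIV \<phi>"
    using d\<phi>(1) by (auto intro!: continuous_at_imp_continuous_on DERIV_isCont)
  from compact_imp_bounded[OF K(1)] obtain B where B: "\<forall>x\<in>K. \<bar>x\<bar> \<le> B" 
    by (auto simp: bounded_iff)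
  \<comment> \<open>Adding 1 puts both endpoints outside \<open>K\<close>; the absolute value keeps
    the interval nonempty even if \<open>K\<close> is empty and \<open>B\<close> is
    negative.\<close>
  define M where "M = \<bar>B\<bar> + 1"
  have M: "K \<subseteq> {-M..M}" "M \<notin> K" "- M \<notin> K" "-M \<le> M" using B by (force simp: M_def)+
  have d0: "deriv \<phi> x = 0" if "x \<notin> K" for x
    using deriv_eq_0_outside[of K \<phi> x] compact_imp_closed[OF K(1)] K(3) that by blast
  \<comment> \<open>Hence both integrals over \<open>S\<close> may be replaced by integrals over the
    interval.\<close>
  have out: "\<phi> x = 0 \<and> deriv \<phi> x = 0" if "x \<notin> S \<or> x \<notin> {-M..M}" for x
  proof -
    have "x \<notin> K" using that K(2) M(1) by blast
    then show ?thesis using K(3) d0 by auto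
  qed
  have I1: "set_integrable lebesgue {-M..M} (\<lambda>x. deriv \<phi> x *\<^sub>R f x)"
    by (intro compact_imp_set_integrable_lebesgue continuous_intros)
      (auto intro: continuous_on_subset[OF d\<phi>(2)] continuous_on_subset[OF contf])
  have I2: "set_integrable lebesgue {-M..M} (\<lambda>x. \<phi> x *\<^sub>R g x)"
    by (intro compact_imp_set_integrable_lebesgue continuous_intros)
      (auto intro: continuous_on_subset[OF contphi] continuous_on_subset[OF cont])
  have e1: "(LINT x:S|lebesgue. deriv \<phi> x *\<^sub>R f x) = (LINT x:{-M..M}|lebesgue. deriv \<phi> x *\<^sub>R f x)"
    unfolding set_lebesgue_integral_def
    by (intro Bochner_Integration.integral_cong refl)
      (use out in \<open>force simp: indicator_def\<close>)
  have e2: "(LINT x:S|lebesgue. \<phi> x *\<^sub>R g x) = (LINT x:{-M..M}|lebesgue. \<phi> x *\<^sub>R g x)"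
    unfolding set_lebesgue_integral_def
    by (intro Bochner_Integration.integral_cong refl)
      (use out in \<open>force simp: indicator_def\<close>)
  have "((\<lambda>x. \<phi> x *\<^sub>R g x + deriv \<phi> x *\<^sub>R f x) has_integral \<phi> M *\<^sub>R f M - \<phi> (-M) *\<^sub>R f (-M)) {-M..M}"
    by (intro fundamental_theorem_of_calculus M has_vector_derivative_scaleR
        has_vector_derivative_at_within[OF der] has_field_derivative_at_within[OF d\<phi>(1)])
  then have "integral {-M..M} (\<lambda>x. \<phi> x *\<^sub>R g x + deriv \<phi> x *\<^sub>R f x) = 0"
    using K M by (simp add: integral_unique)
  then have "(LINT x:{-M..M}|lebesgue. \<phi> x *\<^sub>R g x + deriv \<phi> x *\<^sub>R f x) = 0"
    using set_lebesgue_integral_eq_integral(2)[OF set_integral_add(1)[OF I2 I1]] by simp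
  then show "(LINT x:S|lebesgue. deriv \<phi> x *\<^sub>R f x) = - (LINT x:S|lebesgue. \<phi> x *\<^sub>R g x)"
    unfolding e1 e2 using set_integral_add(2)[OF I2 I1] by (simp add: add_eq_0_iff)
qed

section \<open>Square integrability and traces\<close>

lemma integrable_exp_minus_abs:
  fixes \<kappa> :: real
  assumes "0 < \<kappa>"
  shows "integrable lebesgue (\<lambda>x. exp (- \<kappa> * \<bar>x\<bar>))"
proof -
  have "set_integrable lebesgue {0..} (\<lambda>x. exp (- \<kappa> * x))"
    by (intro nonnegative_absolutely_integrable_1 integrable_on_exp_minus_to_infinity assms) auto
  then have pos: "integrable lborel (\<lambda>x. indicator {0..} x *\<^sub>R exp (- \<kappa> * x))"
    unfolding set_integrable_def
    by (subst (asm) integrable_completion) auto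
  \<comment> \<open>Reflection gives the left half-line; the sum of the two halves dominates the
    symmetric exponential.\<close>
  from lborel_integrable_real_affine[OF this, of "-1" 0]
  have neg: "integrable lborel (\<lambda>x. indicator {0..} (- x) *\<^sub>R exp (\<kappa> * x))" by simp
  have "integrable lborel (\<lambda>x. exp (- \<kappa> * \<bar>x\<bar>))"
    by (rule Bochner_Integration.integrable_bound[OF Bochner_Integration.integrable_add[OF pos neg]])
      (auto simp: indicator_def)
  then show ?thesis by (subst integrable_completion) auto
qed

text \<open>Decay is required on \<open>S\<close> only, since the functions in question may grow
  beyond the vertex; continuity on the whole line supplies measurability.\<close>

lemma L2_of_exponential_decay:
  fixes f :: "real \<Rightarrow> complex" and \<kappa> C :: real
  assumes S: "S \<in> sets borel" and cont: "continuous_on UNIV f" and "0 < \<kappa>"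
    and bound: "\<And>x. x \<in> S \<Longrightarrow> norm (f x) \<le> C * exp (- \<kappa> * \<bar>x\<bar>)"
  shows "f \<in> L2 S"
proof -
  have meas: "(\<lambda>x. indicator S x *\<^sub>R f x) \<in> borel_measurable borel"
    using S cont by (intro borel_measurable_continuous_on_indicator) (auto intro: continuous_on_subset)
  have meas2: "(\<lambda>x. indicator S x *\<^sub>R (norm (f x))\<^sup>2) \<in> borel_measurable borel"
    using S cont by (intro borel_measurable_continuous_on_indicator continuous_intros)
      (auto intro: continuous_on_subset)
  have "integrable lebesgue (\<lambda>x. C\<^sup>2 * exp (- (2 * \<kappa>) * \<bar>x\<bar>))"
    using integrable_exp_minus_abs[of "2 * \<kappa>"] \<open>0 < \<kappa>\<close> by (intro integrable_mult_right) auto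
  then have "integrable lebesgue (\<lambda>x. indicator S x *\<^sub>R (norm (f x))\<^sup>2)"
  proof (rule Bochner_Integration.integrable_bound)
    show "(\<lambda>x. indicator S x *\<^sub>R (norm (f x))\<^sup>2) \<in> borel_measurable lebesgue"
      using meas2 by (simp add: measurable_completion)
    show "AE x in lebesgue. norm (indicator S x *\<^sub>R (norm (f x))\<^sup>2)
        \<le> norm (C\<^sup>2 * exp (- (2 * \<kappa>) * \<bar>x\<bar>))"
    proof (rule AE_I2)
      fix x
      have "(norm (f x))\<^sup>2 \<le> C\<^sup>2 * exp (- (2 * \<kappa>) * \<bar>x\<bar>)" if "x \<in> S"
      proof -
        have "(norm (f x))\<^sup>2 \<le> (C * exp (- \<kappa> * \<bar>x\<bar>))\<^sup>2"
          by (intro power_mono bound that) auto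
        also have "\<dots> = C\<^sup>2 * exp (- (2 * \<kappa>) * \<bar>x\<bar>)"
          by (simp add: power_mult_distrib flip: exp_double)
        finally show ?thesis .
      qed
      then show "norm (indicator S x *\<^sub>R (norm (f x))\<^sup>2) \<le> norm (C\<^sup>2 * exp (- (2 * \<kappa>) * \<bar>x\<bar>))"
        by (auto simp: indicator_def)
    qed
  qed
  then show ?thesis
    using meas by (simp add: L2_def set_borel_measurable_def set_integrable_def measurable_completion)
qed

lemma has_trace_continuous:
  assumes "continuous_on UNIV f"
  shows "has_trace e f (f 0)"
proof -
  have "(f \<longlongrightarrow> f 0) (at 0)" using assms by (simp add: continuous_on_def)
  then have "(f \<longlongrightarrow> f 0) (vertex e)" using tendsto_mono[OF vertex_le_at] by blast
  then show ?thesis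
    unfolding has_trace_def using assms by (auto intro: continuous_on_subset)
qed


section \<open>The eigenfunction\<close>

text \<open>The image of \<open>exp (- k * x)\<close> under the operator -d/dx + tanh(x - a). This
  Darboux transformation carries solutions of -f'' + f = (1 - k^2) f to solutions of the same
  equation with the kink potential.\<close>

definition wave :: "real \<Rightarrow> real \<Rightarrow> real \<Rightarrow> real" where
  "wave a k x = exp (- k * x) * (k + tanh (x - a))"

definition wave' :: "real \<Rightarrow> real \<Rightarrow> real \<Rightarrow> real" where
  "wave' a k x = exp (- k * x) * (1 - (tanh (x - a))\<^sup>2 - k * (k + tanh (x - a)))"

text \<open>The coefficient is the potential plus \<open>k\<^sup>2 - 1\<close>, so the eigenvalue
  equation can be read off.\<close>

definition wave'' :: "real \<Rightarrow> real \<Rightarrow> real \<Rightarrow> real" where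
  "wave'' a k x = (k\<^sup>2 - 2 + 2 * (tanh (x - a))\<^sup>2) * wave a k x"

lemma wave_deriv: "(wave a k has_real_derivative wave' a k x) (at x)"
  unfolding wave_def[abs_def] wave'_def
  by (auto intro!: derivative_eq_intros simp: algebra_simps)

lemma wave'_deriv: "(wave' a k has_real_derivative wave'' a k x) (at x)"
  unfolding wave'_def[abs_def] wave''_def wave_def
  by (auto intro!: derivative_eq_intros simp: algebra_simps power2_eq_square)

lemma continuous_on_wave: "continuous_on A (wave a k)" "continuous_on A (wave' a k)"
    "continuous_on A (wave'' a k)"
  unfolding wave_def[abs_def] wave'_def[abs_def] wave''_def[abs_def]
  by (intro continuous_intros; simp)+

text \<open>The hypothesis says that \<open>k\<close> and \<open>x\<close> do not have opposite
  signs, that is, \<open>x\<close> lies on the side where the exponential decays. The rest follows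
  from \<open>\<bar>tanh\<bar> < 1\<close>.\<close>

lemma wave_bounds:
  assumes "k * x = \<bar>k\<bar> * \<bar>x\<bar>"
  shows "\<bar>wave a k x\<bar> \<le> (\<bar>k\<bar> + 1) * exp (- \<bar>k\<bar> * \<bar>x\<bar>)"
    and "\<bar>wave' a k x\<bar> \<le> (1 + \<bar>k\<bar> * (\<bar>k\<bar> + 1)) * exp (- \<bar>k\<bar> * \<bar>x\<bar>)"
    and "\<bar>wave'' a k x\<bar> \<le> ((k\<^sup>2 + 4) * (\<bar>k\<bar> + 1)) * exp (- \<bar>k\<bar> * \<bar>x\<bar>)"
proof -
  let ?t = "tanh (x - a)"
  have t: "\<bar>?t\<bar> < 1" using tanh_real_bounds[of "x - a"] by auto
  then have t2: "?t\<^sup>2 < 1" "0 \<le> ?t\<^sup>2" by (auto simp: abs_square_less_1)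
  have kt: "\<bar>k + ?t\<bar> \<le> \<bar>k\<bar> + 1" using t by linarith
  have ex: "exp (- k * x) = exp (- \<bar>k\<bar> * \<bar>x\<bar>)" using assms by simp
  show b: "\<bar>wave a k x\<bar> \<le> (\<bar>k\<bar> + 1) * exp (- \<bar>k\<bar> * \<bar>x\<bar>)"
    unfolding wave_def ex abs_mult using kt by (simp add: mult.commute)
  have "\<bar>1 - ?t\<^sup>2 - k * (k + ?t)\<bar> \<le> \<bar>1 - ?t\<^sup>2\<bar> + \<bar>k * (k + ?t)\<bar>" by linarith
  also have "\<dots> \<le> 1 + \<bar>k\<bar> * (\<bar>k\<bar> + 1)"
    unfolding abs_mult using t2 kt by (intro add_mono mult_left_mono) auto
  finally show "\<bar>wave' a k x\<bar> \<le> (1 + \<bar>k\<bar> * (\<bar>k\<bar> + 1)) * exp (- \<bar>k\<bar> * \<bar>x\<bar>)"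
    unfolding wave'_def ex abs_mult by (simp add: mult.commute)
  have "\<bar>k\<^sup>2 - 2 + 2 * ?t\<^sup>2\<bar> \<le> k\<^sup>2 + 4" using t2 zero_le_power2[of k] by linarith
  then have "\<bar>wave'' a k x\<bar> \<le> (k\<^sup>2 + 4) * ((\<bar>k\<bar> + 1) * exp (- \<bar>k\<bar> * \<bar>x\<bar>))"
    unfolding wave''_def abs_mult using b by (intro mult_mono) auto
  then show "\<bar>wave'' a k x\<bar> \<le> ((k\<^sup>2 + 4) * (\<bar>k\<bar> + 1)) * exp (- \<bar>k\<bar> * \<bar>x\<bar>)"
    by (simp add: mult.assoc)
qed

text \<open>The sign makes the exponential decay towards the infinite end of each edge.\<close>

fun rate :: "real \<Rightarrow> edge \<Rightarrow> real" where
  "rate k E1 = - k"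
| "rate k E2 = k"
| "rate k E3 = k"

text \<open>\<open>amplitude a k e\<close> is chosen so that the product with \<open>wave a (rate k e) 0\<close>, where
  \<open>wave a k 0 = k - tanh a\<close>, is the same on all edges.\<close>

fun amplitude :: "real \<Rightarrow> real \<Rightarrow> edge \<Rightarrow> real" where
  "amplitude a k E1 = k - tanh a"
| "amplitude a k E2 = - (k + tanh a)"
| "amplitude a k E3 = - (k + tanh a)"

text \<open>The factor \<open>c\<close> lets one family contain the eigenfunction
  (\<open>c = 1\<close>), the zero function (\<open>c = 0\<close>) and the velocity component, so
  regularity is proved once for all of them.\<close>

definition mode :: "real \<Rightarrow> real \<Rightarrow> complex \<Rightarrow> yfun" where
  "mode a k c = (\<lambda>e x. c * of_real (amplitude a k e * wave a (rate k e) x))"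

definition mode' :: "real \<Rightarrow> real \<Rightarrow> complex \<Rightarrow> yfun" where
  "mode' a k c = (\<lambda>e x. c * of_real (amplitude a k e * wave' a (rate k e) x))"

definition mode'' :: "real \<Rightarrow> real \<Rightarrow> complex \<Rightarrow> yfun" where
  "mode'' a k c = (\<lambda>e x. c * of_real (amplitude a k e * wave'' a (rate k e) x))"

text \<open>The defect in the jump condition, a cubic polynomial in \<open>k\<close>. The factor 2
  collects the equal contributions of \<open>E2\<close> and \<open>E3\<close>.\<close>

definition mode_eq :: "real \<Rightarrow> real \<Rightarrow> real \<Rightarrow> real" where
  "mode_eq Z a k = 2 * amplitude a k E2 * wave' a k 0 - amplitude a k E1 * wave' a (- k) 0
     - Z * (amplitude a k E1 * wave a (- k) 0)"

section \<open>Regularity, vertex conditions and eigenvalue equation of the modes\<close>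

lemma continuous_on_mode: "continuous_on A (mode a k c e)" "continuous_on A (mode' a k c e)"
    "continuous_on A (mode'' a k c e)"
  unfolding mode_def mode'_def mode''_def by (intro continuous_intros continuous_on_wave)+

lemma weak_derivative_mode:
  "weak_derivative S (mode a k c e) (mode' a k c e)"
  "weak_derivative S (mode' a k c e) (mode'' a k c e)"
proof -
  have *: "((\<lambda>x. c * of_real (A * f x)) has_vector_derivative c * of_real (A * d)) (at x)"
    if "(f has_real_derivative d) (at x)" for A x d and f :: "real \<Rightarrow> real"
    by (intro has_vector_derivative_mult_right has_vector_derivative_of_real DERIV_cmult that)
  show "weak_derivative S (mode a k c e) (mode' a k c e)"
    by (rule weak_derivative_classical[OF _ continuous_on_mode(2)])
      (unfold mode_def mode'_def, intro * wave_deriv)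
  show "weak_derivative S (mode' a k c e) (mode'' a k c e)"
    by (rule weak_derivative_classical[OF _ continuous_on_mode(3)])
      (unfold mode'_def mode''_def, intro * wave'_deriv)
qed

lemma borel_Edge: "Edge e \<in> sets borel"
  by (cases e) auto

lemma L2_mode:
  assumes "0 < k"
  shows "mode a k c e \<in> L2 (Edge e)" "mode' a k c e \<in> L2 (Edge e)" "mode'' a k c e \<in> L2 (Edge e)"
proof -
  have rate: "rate k e * x = \<bar>rate k e\<bar> * \<bar>x\<bar>" if "x \<in> Edge e" for x
    using that assms by (cases e) auto
  have abs: "\<bar>rate k e\<bar> = k" using assms by (cases e) auto
  have *: "norm (c * of_real (A * y)) \<le> (norm c * \<bar>A\<bar> * C) * exp (- k * \<bar>x\<bar>)"
    if "\<bar>y\<bar> \<le> C * exp (- k * \<bar>x\<bar>)" for A y C x :: real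
    using mult_left_mono[OF that, of "norm c * \<bar>A\<bar>"] by (simp add: norm_mult abs_mult mult_ac)
  show "mode a k c e \<in> L2 (Edge e)" 
    by (rule L2_of_exponential_decay[OF borel_Edge continuous_on_mode(1) assms])
      (unfold mode_def, rule *, use wave_bounds(1)[OF rate] in \<open>simp only: abs\<close>)
  show "mode' a k c e \<in> L2 (Edge e)" 
    by (rule L2_of_exponential_decay[OF borel_Edge continuous_on_mode(2) assms])
      (unfold mode'_def, rule *, use wave_bounds(2)[OF rate] in \<open>simp only: abs\<close>)
  show "mode'' a k c e \<in> L2 (Edge e)" 
    by (rule L2_of_exponential_decay[OF borel_Edge continuous_on_mode(3) assms])
      (unfold mode''_def, rule *, use wave_bounds(3)[OF rate] in \<open>simp only: abs\<close>)
qed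

lemma HY_mode:
  assumes "0 < k"
  shows "mode a k c \<in> HY 1" "mode a k c \<in> HY 2"
proof -
  have "mode' a k c e \<in> Sobolev 1 (Edge e)" for e
    using L2_mode(2,3)[OF assms] weak_derivative_mode(2) by (simp, blast)
  then show "mode a k c \<in> HY 1" "mode a k c \<in> HY 2"
    using L2_mode(1,2)[OF assms] weak_derivative_mode(1)
    by (simp_all add: HY_def numeral_2_eq_2) blast+
qed

lemma mode_at_0: "mode a k c e 0 = mode a k c E1 0"
  by (cases e) (simp_all add: mode_def wave_def algebra_simps)

lemma has_trace_mode: "has_trace e (mode a k c e) (mode a k c E1 0)"
  using has_trace_continuous[OF continuous_on_mode(1), of e a k c e] mode_at_0[of a k c e] by simp

lemma EY_mode: "0 < k \<Longrightarrow> mode a k c \<in> EY"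
  using HY_mode(1) has_trace_mode unfolding EY_def by blast

lemma D_L_mode:
  assumes "0 < k" "mode_eq Z a k = 0"
  shows "mode a k c \<in> D_L Z"
proof -
  have "mode' a k c E2 0 + mode' a k c E3 0 - mode' a k c E1 0 - of_real Z * mode a k c E1 0
      = c * of_real (mode_eq Z a k)"
    by (simp add: mode_eq_def mode_def mode'_def algebra_simps)
  then have "mode' a k c E2 0 + mode' a k c E3 0 - mode' a k c E1 0 = of_real Z * mode a k c E1 0"
    using assms(2) by simp
  then show ?thesis
    unfolding D_L_def
    by (intro CollectI conjI HY_mode assms(1) exI[of _ "mode' a k c"] exI[of _ "mode a k c E1 0"]
        exI[of _ "\<lambda>e. mode' a k c e 0"] allI weak_derivative_mode has_trace_mode
        has_trace_continuous continuous_on_mode)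
qed

lemma mode_eigenfunction:
  fixes a k :: real
  shows "- mode'' a k c e x + of_real (cos (4 * arctan (exp (- (x - a))))) * mode a k c e x
    = of_real (1 - k\<^sup>2) * mode a k c e x"
proof -
  have "(rate k e)\<^sup>2 = k\<^sup>2" by (cases e) auto
  then have "- wave'' a (rate k e) x + cos (4 * arctan (exp (- (x - a)))) * wave a (rate k e) x
      = (1 - k\<^sup>2) * wave a (rate k e) x"
    unfolding wave''_def kink_cos by (simp add: algebra_simps)
  then have "c * of_real (amplitude a k e * (- wave'' a (rate k e) x
        + cos (4 * arctan (exp (- (x - a)))) * wave a (rate k e) x))
      = c * of_real (amplitude a k e * ((1 - k\<^sup>2) * wave a (rate k e) x))" by simp
  then show ?thesis by (simp add: mode_def mode''_def algebra_simps)
qed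

section \<open>From a mode with k > 1 to instability, and existence of such a k\<close>

lemma mode_nonzero:
  assumes "1 < k" "c \<noteq> 0"
  shows "mode a k c E2 x \<noteq> 0"
proof -
  have "0 < k + tanh a" "0 < k + tanh (x - a)"
    using assms(1) tanh_real_gt_neg1[of a] tanh_real_gt_neg1[of "x - a"] by linarith+
  then show ?thesis using assms(2) by (simp add: mode_def wave_def del: of_real_mult of_real_minus)
qed

text \<open>The states for \<open>c = 1\<close> and \<open>c = 0\<close> both solve the resolvent
  equation with right-hand side 0 but differ on a set of positive measure, so injectivity fails at a
  positive real number.\<close>

lemma mode_unstable:
  assumes "1 < k" "mode_eq Z a k = 0"
  shows "spectrally_unstable Z (kink_antikink a)"
proof -
  \<comment> \<open>If L u = (1 - k^2) u, then the linearization maps (u, l u) to (l u, (k^2 - 1)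
    u), which is l (u, l u).\<close>
  define l where "l = sqrt (k\<^sup>2 - 1)"
  have "1 < k\<^sup>2" using assms(1) by (simp add: one_less_power)
  then have l: "0 < l" "l\<^sup>2 = k\<^sup>2 - 1" by (simp_all add: l_def)
  define A where "A = JE_op Z (fst (kink_antikink a))"
  define v where "v c = mode a k (of_real l * c)" for c
  have k: "0 < k" using assms(1) by simp
  have v_eq: "v c e x = of_real l * mode a k c e x" for c e x
    by (simp add: v_def mode_def)
  have graph: "((mode a k c, v c), (v c, \<lambda>e x. - (of_real (1 - k\<^sup>2) * mode a k c e x))) \<in> A" for c
  proof -
    have "(mode a k c, \<lambda>e x. of_real (1 - k\<^sup>2) * mode a k c e x) \<in> L_op Z (fst (kink_antikink a))"
      unfolding L_op_def
    proof (intro CollectI case_prodI conjI exI allI)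
      show "mode a k c \<in> D_L Z" by (rule D_L_mode[OF k assms(2)])
      show "weak_derivative (Edge e) (mode a k c e) (mode' a k c e)"
        "weak_derivative (Edge e) (mode' a k c e) (mode'' a k c e)" for e
        by (rule weak_derivative_mode)+
      show "(\<lambda>e x. of_real (1 - k\<^sup>2) * mode a k c e x) = (\<lambda>e x. - mode'' a k c e x
          + of_real (cos (fst (kink_antikink a) e x)) * mode a k c e x)"
        unfolding kink_antikink_def fst_conv mode_eigenfunction ..
    qed
    moreover have "v c \<in> EY" unfolding v_def by (rule EY_mode[OF k])
    ultimately show ?thesis
      unfolding A_def JE_op_def
      by (intro CollectI exI[of _ "mode a k c"] exI[of _ "v c"]
          exI[of _ "\<lambda>e x. of_real (1 - k\<^sup>2) * mode a k c e x"] conjI) auto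
  qed
  have cancel: "of_real l * (of_real l * y) + of_real (1 - k\<^sup>2) * y = 0" for y :: complex
  proof -
    have "of_real l * (of_real l * y) + of_real (1 - k\<^sup>2) * y = of_real (l\<^sup>2 + (1 - k\<^sup>2)) * y"
      by (simp add: power2_eq_square algebra_simps)
    then show ?thesis using l(2) by simp
  qed
  have sol: "resolvent_eq A (of_real l) (mode a k c, v c) (\<lambda>e x. 0, \<lambda>e x. 0)" for c
    unfolding resolvent_eq.simps
    by (intro exI, rule conjI[OF graph]) (simp add: ae_eq_def v_eq cancel del: of_real_diff)
  have "(\<lambda>e x. 0) = mode a k 0" by (simp add: mode_def fun_eq_iff)
  then have zero: "((\<lambda>e x. 0, \<lambda>e x. 0) :: yfun \<times> yfun) \<in> energy_space"
    using EY_mode[OF k, of a 0] L2_mode(1)[OF k, of a 0] by (simp add: energy_space_def L2Y_def)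
  have neq: "\<not> state_eq (mode a k 1, v 1) (mode a k 0, v 0)"
  proof
    assume "state_eq (mode a k 1, v 1) (mode a k 0, v 0)"
    then have "AE x in lebesgue. x \<in> Edge E2 \<longrightarrow> mode a k 1 E2 x = mode a k 0 E2 x"
      unfolding state_eq.simps ae_eq_def by blast
    moreover have "mode a k 1 E2 x \<noteq> mode a k 0 E2 x" for x
      using mode_nonzero[OF assms(1), of 1 a x] by (simp add: mode_def)
    ultimately have "AE x in lebesgue. (x::real) \<notin> {0<..}" by simp
    then have "AE x in lborel. (x::real) \<notin> {0<..}" by (simp add: AE_completion_iff)
    then have "{0<..} \<in> null_sets (lborel :: real measure)" by (subst AE_iff_null_sets) auto
    \<comment> \<open>A bounded subinterval has the explicit measure 1, which contradicts being
      null.\<close>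
    then have "{0<..<1} \<in> null_sets (lborel :: real measure)" by (rule null_sets_subset) auto
    then show False by (simp add: null_sets_def)
  qed
  have "of_real l \<in> spectrum A"
    unfolding spectrum_def resolvent_set_def Compl_iff mem_Collect_eq
    using sol[of 1] sol[of 0] zero neq by metis
  then show ?thesis
    using l(1) unfolding spectrally_unstable_def spectrally_stable_def A_def by auto
qed

text \<open>Intermediate values of the cubic between 1 and 4. At 1 it factors as
  \<open>(1 - T\<^sup>2) * (Z - T)\<close>, which is negative.\<close>

lemma mode_eq_root:
  assumes "- 1 < Z" "Z < tanh a"
  obtains k where "1 < k" "mode_eq Z a k = 0"
proof -
  define T where "T = tanh a"
  have T: "- 1 < T" "T < 1" using tanh_real_bounds[of a] by (auto simp: T_def)
  have eq: "mode_eq Z a k = - 2 * (k + T) * (1 - T\<^sup>2 - k * (k - T)) - (k - T) * (1 - T\<^sup>2 - k * (k + T))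
      + Z * (k\<^sup>2 - T\<^sup>2)" for k
    by (simp add: mode_eq_def wave_def wave'_def T_def algebra_simps power2_eq_square)
  have "mode_eq Z a 1 = (1 - T\<^sup>2) * (Z - T)"
    unfolding eq by (simp add: algebra_simps power2_eq_square)
  moreover have "0 < 1 - T\<^sup>2" using T by (simp add: abs_square_less_1 abs_less_iff)
  ultimately have neg: "mode_eq Z a 1 < 0" using assms(2) by (simp add: T_def mult_pos_neg)
  have T2: "0 \<le> T\<^sup>2" "T\<^sup>2 < 1" using \<open>0 < 1 - T\<^sup>2\<close> by auto
  \<comment> \<open>The point 4 is a convenient large value: since \<open>T\<close> lies in
    \<open>(-1, 1)\<close> and \<open>Z > -1\<close>, the term \<open>2 * P + Q\<close> is at least
    90, whereas \<open>R\<close> is at least -16.\<close>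
  define P Q R where "P = (4 + T) * (T\<^sup>2 + 15 - 4 * T)" and "Q = (4 - T) * (T\<^sup>2 + 15 + 4 * T)"
    and "R = Z * (16 - T\<^sup>2)"
  have "3 * 10 \<le> P" unfolding P_def by (intro mult_mono; use T T2 in linarith)
  moreover have "3 * 10 \<le> Q" unfolding Q_def by (intro mult_mono; use T T2 in linarith)
  moreover have "- (16 - T\<^sup>2) \<le> R"
    unfolding R_def using mult_right_mono[of "- 1" Z "16 - T\<^sup>2"] assms(1) T2 by simp
  moreover have "mode_eq Z a 4 = 2 * P + Q + R"
    unfolding eq P_def Q_def R_def by (simp add: algebra_simps power2_eq_square)
  ultimately have pos: "0 \<le> mode_eq Z a 4" using T2 by linarith
  have "\<exists>k\<ge>1. k \<le> 4 \<and> mode_eq Z a k = 0"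
    using neg pos unfolding eq by (intro IVT') (auto intro!: continuous_intros)
  then obtain k where "1 \<le> k" "mode_eq Z a k = 0" by blast
  moreover with neg have "k \<noteq> 1" by auto
  ultimately show thesis using that by force
qed

theorem theorem5p1:
  fixes Z :: real
  assumes "- 1 < Z" and "Z < 0"
  shows "(\<exists>!a. - exp a / (1 + exp (2 * a)) = Z * arctan (exp a)) \<and>
         (\<forall>a. - exp a / (1 + exp (2 * a)) = Z * arctan (exp a) \<longrightarrow>
              stationary Z (kink_antikink a) \<and> spectrally_unstable Z (kink_antikink a))"
proof (intro conjI allI impI)
  show "\<exists>!a. - exp a / (1 + exp (2 * a)) = Z * arctan (exp a)"
    by (rule shift_exists_unique[OF assms])
  fix a assume a: "- exp a / (1 + exp (2 * a)) = Z * arctan (exp a)"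
  then show "stationary Z (kink_antikink a)" by (rule stationary_kink)
  from mode_eq_root[OF assms(1) shift_tanh_gt[OF a]]
  show "spectrally_unstable Z (kink_antikink a)" using mode_unstable by blast
qed

end
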